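(* Let $\mathfrak{B}$ be a temporal structure preserved by $\mathrm{mx}$. Then $\mathfrak{B}$ admits a primitive positive definition of the relation $\mathrm{X}$, or one of the following holds: (1) $\mathfrak{B}$ is preserved by a constant operation; (2) $\mathfrak{B}$ is preserved by $\min$.
   Context: A temporal structure is a relational structure with domain $\mathbb{Q}$ and a finite relational signature all of whose relations are first-order definable in $(\mathbb{Q};<)$. An $n$-ary operation $f$ on $\mathbb{Q}$ preserves $\mathfrak{B}$ if for each relation $R$ of $\mathfrak{B}$ and all $t_1,\dots,t_n\in R$, applying $f$ componentwise yields a tuple of $R$. $\min$ is the binary minimum. Fix strictly increasing maps $\alpha,\beta:\mathbb{Q}\to\mathbb{Q}$ with $\alpha(x)<\beta(x)<\alpha(x+\varepsilon)$ for all $x\in\mathbb{Q}$, $\varepsilon\in\mathbb{Q}_{>0}$; then $\mathrm{mx}(x,y)=\alpha(\min(x,y))$ if $x\neq y$ and $\mathrm{mx}(x,y)=\beta(\min(x,y))$ if $x=y$. $\mathrm{X}=\{(x,y,z)\in\mathbb{Q}^3: x=y<z \text{ or } y=z<x \text{ or } z=x<y\}$. A relation is primitive positive definable in $\mathfrak{B}$ if it is definable by a formula of the form $\exists \bar x(\phi_1\wedge\dots\wedge\phi_m)$ with each $\phi_i$ atomic (including equalities). *)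

theory Defs
  imports Complex_Main
begin

section \<open>Relational structures and first-order formulas\<close>

text \<open>
  The domain of a structure is the whole type \<open>'a\<close>; an \<open>n\<close>-tuple is a list of length \<open>n\<close>.
  The signature is the set \<open>symbols\<close>, which may be empty; \<open>arity\<close> and \<open>interp\<close> carry no
  meaning outside it.
\<close>

record ('s, 'a) relational_structure =
  symbols :: "'s set"
  arity :: "'s \<Rightarrow> nat"
  interp :: "'s \<Rightarrow> 'a list set"

datatype 's atom = Rel 's "nat list" | Eq nat nat

datatype 's fm = Atom "'s atom" | Neg "'s fm" | Conj "'s fm" "'s fm" | Ex nat "'s fm"

primrec atom_vars :: "'s atom \<Rightarrow> nat set" where
  "atom_vars (Rel s is) = set is"
| "atom_vars (Eq i j) = {i, j}"

primrec free_vars :: "'s fm \<Rightarrow> nat set" where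
  "free_vars (Atom p) = atom_vars p"
| "free_vars (Neg \<phi>) = free_vars \<phi>"
| "free_vars (Conj \<phi> \<psi>) = free_vars \<phi> \<union> free_vars \<psi>"
| "free_vars (Ex i \<phi>) = free_vars \<phi> - {i}"

primrec wf_atom :: "('s, 'a) relational_structure \<Rightarrow> 's atom \<Rightarrow> bool" where
  "wf_atom B (Rel s is) \<longleftrightarrow> s \<in> symbols B \<and> length is = arity B s"
| "wf_atom B (Eq i j) \<longleftrightarrow> True"

primrec wf_fm :: "('s, 'a) relational_structure \<Rightarrow> 's fm \<Rightarrow> bool" where
  "wf_fm B (Atom p) \<longleftrightarrow> wf_atom B p"
| "wf_fm B (Neg \<phi>) \<longleftrightarrow> wf_fm B \<phi>"
| "wf_fm B (Conj \<phi> \<psi>) \<longleftrightarrow> wf_fm B \<phi> \<and> wf_fm B \<psi>"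
| "wf_fm B (Ex i \<phi>) \<longleftrightarrow> wf_fm B \<phi>"

primrec sat_atom :: "('s, 'a) relational_structure \<Rightarrow> (nat \<Rightarrow> 'a) \<Rightarrow> 's atom \<Rightarrow> bool" where
  "sat_atom B v (Rel s is) \<longleftrightarrow> map v is \<in> interp B s"
| "sat_atom B v (Eq i j) \<longleftrightarrow> v i = v j"

primrec sat :: "('s, 'a) relational_structure \<Rightarrow> (nat \<Rightarrow> 'a) \<Rightarrow> 's fm \<Rightarrow> bool" where
  "sat B v (Atom p) \<longleftrightarrow> sat_atom B v p"
| "sat B v (Neg \<phi>) \<longleftrightarrow> \<not> sat B v \<phi>"
| "sat B v (Conj \<phi> \<psi>) \<longleftrightarrow> sat B v \<phi> \<and> sat B v \<psi>"
| "sat B v (Ex i \<phi>) \<longleftrightarrow> (\<exists>a. sat B (v(i := a)) \<phi>)"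

text \<open>
  Below, the list \<open>xs\<close> serves as the valuation \<open>nth xs\<close>. Its unspecified values beyond the end
  of the list are irrelevant because of the restrictions on the free variables.
\<close>

definition fo_definable ::
    "('s, 'a) relational_structure \<Rightarrow> nat \<Rightarrow> 'a list set \<Rightarrow> bool" where
  "fo_definable B n R \<longleftrightarrow>
     (\<exists>\<phi>. wf_fm B \<phi> \<and> free_vars \<phi> \<subseteq> {..<n} \<and> R = {xs. length xs = n \<and> sat B (nth xs) \<phi>})"

text \<open>
  In the formula \<open>\<exists>y\<^sub>1 \<dots> y\<^sub>k. \<phi>\<^sub>1 \<and> \<dots> \<and> \<phi>\<^sub>m\<close> the free variables are \<open>0, \<dots>, n - 1\<close>, the
  bound ones are \<open>n, \<dots>, n + k - 1\<close>, and \<open>ps\<close> is the list of the atomic formulas \<open>\<phi>\<^sub>i\<close>.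
\<close>

definition pp_definable ::
    "('s, 'a) relational_structure \<Rightarrow> nat \<Rightarrow> 'a list set \<Rightarrow> bool" where
  "pp_definable B n R \<longleftrightarrow>
     (\<exists>k ps. (\<forall>p\<in>set ps. wf_atom B p \<and> atom_vars p \<subseteq> {..<n + k}) \<and>
        R = {xs. length xs = n \<and>
               (\<exists>ys. length ys = k \<and> (\<forall>p\<in>set ps. sat_atom B (nth (xs @ ys)) p))})"


section \<open>Operations and preservation\<close>

text \<open>
  An \<open>n\<close>-ary operation is a function on lists of which only the values on lists of length \<open>n\<close>
  matter. The \<open>i\<close>-th entry of the image tuple is \<open>f\<close> applied to the \<open>i\<close>-th entries of the \<open>n\<close>
  tuples in \<open>ts\<close>.
\<close>

definition preserved_by ::
    "('s, 'a) relational_structure \<Rightarrow> nat \<Rightarrow> ('a list \<Rightarrow> 'a) \<Rightarrow> bool" where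
  "preserved_by B n f \<longleftrightarrow>
     (\<forall>s\<in>symbols B. \<forall>ts. length ts = n \<and> set ts \<subseteq> interp B s \<longrightarrow>
        map (\<lambda>i. f (map (\<lambda>t. t ! i) ts)) [0..<arity B s] \<in> interp B s)"

definition binary_op :: "('a \<Rightarrow> 'a \<Rightarrow> 'a) \<Rightarrow> 'a list \<Rightarrow> 'a" where
  "binary_op g ts = g (ts ! 0) (ts ! 1)"

definition constant_operation :: "nat \<Rightarrow> ('a list \<Rightarrow> 'a) \<Rightarrow> bool" where
  "constant_operation n f \<longleftrightarrow> n \<ge> 1 \<and> (\<exists>c. \<forall>ts. length ts = n \<longrightarrow> f ts = c)"


section \<open>Temporal structures\<close>

definition rat_order :: "(unit, rat) relational_structure" where
  "rat_order = \<lparr>symbols = {()}, arity = (\<lambda>_. 2), interp = (\<lambda>_. {[x, y] | x y. x < y})\<rparr>"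

definition temporal_structure :: "('s, rat) relational_structure \<Rightarrow> bool" where
  "temporal_structure B \<longleftrightarrow>
     finite (symbols B) \<and> (\<forall>s\<in>symbols B. fo_definable rat_order (arity B s) (interp B s))"

definition mx :: "(rat \<Rightarrow> rat) \<Rightarrow> (rat \<Rightarrow> rat) \<Rightarrow> rat \<Rightarrow> rat \<Rightarrow> rat" where
  "mx \<alpha> \<beta> x y = (if x \<noteq> y then \<alpha> (min x y) else \<beta> (min x y))"

definition X_rel :: "rat list set" where
  "X_rel = {[x, y, z] | x y z. (x = y \<and> y < z) \<or> (y = z \<and> z < x) \<or> (z = x \<and> x < y)}"

end

theory Submission
  imports Defs
begin

text \<open>
  For a tuple \<open>r\<close> and a set \<open>S\<close> of coordinates let \<open>minset S r\<close> be the set of coordinates in \<open>S\<close>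
  at which \<open>r\<close> is minimal on \<open>S\<close>. If a relation is preserved by \<open>mx\<close>, then for fixed \<open>S\<close> the
  sets \<open>minset S r\<close> form, together with the empty set, a vector space over the two-element field,
  and the tuples of the relation are exactly those whose minimal sets all belong to these spaces.
  Such a relation is preserved by \<open>min\<close> if the spaces are closed under union.

  If \<open>B\<close> is not preserved by constants, some relation of \<open>B\<close> has no constant tuple on \<open>S\<close>; for
  minimal \<open>S\<close>, identifying the coordinates in a minimal set \<open>C\<close> and those in \<open>S - C\<close> defines \<open><\<close>.
  If \<open>B\<close> is not preserved by \<open>min\<close>, some space contains \<open>C\<close> and \<open>D\<close> but not \<open>C \<union> D\<close>. Identifying the
  coordinates within \<open>C \<inter> D\<close>, \<open>C - D\<close> and \<open>D - C\<close>, and placing those outside \<open>C \<union> D\<close> above the ones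
  in \<open>C \<inter> D\<close>, leaves the space generated by \<open>110\<close> and \<open>101\<close>, and this defines \<open>X\<close>.
\<close>

section \<open>Order types of tuples\<close>

text \<open>For finite \<open>S\<close> and rational values this says that \<open>v\<close> and
  \<open>w\<close>, restricted to \<open>S\<close>, lie in one orbit of the automorphism group of
  the rational order; the local form avoids constructing automorphisms.\<close>

definition order_equiv :: "'i set \<Rightarrow> ('i \<Rightarrow> 'a::linorder) \<Rightarrow> ('i \<Rightarrow> 'a) \<Rightarrow> bool" where
  "order_equiv S v w \<longleftrightarrow> (\<forall>i\<in>S. \<forall>j\<in>S. v i < v j \<longleftrightarrow> w i < w j)"

lemma order_equivD: "order_equiv S v w \<Longrightarrow> i \<in> S \<Longrightarrow> j \<in> S \<Longrightarrow> v i < v j \<longleftrightarrow> w i < w j"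
  by (simp add: order_equiv_def)

lemma order_equiv_eqD: "order_equiv S v w \<Longrightarrow> i \<in> S \<Longrightarrow> j \<in> S \<Longrightarrow> v i = v j \<longleftrightarrow> w i = w j"
  using order_equivD[of S v w i j] order_equivD[of S v w j i] linorder_neq_iff[of "v i" "v j"]
    linorder_neq_iff[of "w i" "w j"] by blast

lemma order_equiv_sym: "order_equiv S v w \<Longrightarrow> order_equiv S w v"
  by (simp add: order_equiv_def)

lemma order_equiv_trans: "order_equiv S u v \<Longrightarrow> order_equiv S v w \<Longrightarrow> order_equiv S u w"
  by (simp add: order_equiv_def)

lemma order_equiv_subset: "order_equiv S v w \<Longrightarrow> T \<subseteq> S \<Longrightarrow> order_equiv T v w"
  by (auto simp: order_equiv_def)

lemma order_equiv_strict_mono: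
  assumes "strict_mono g"
  shows "order_equiv S v (\<lambda>i. g (v i))"
  using strict_mono_less[OF assms] by (simp add: order_equiv_def)

text \<open>An affine map does this. It moves a tuple with two relevant levels to prescribed values
  without changing its order type.\<close>

lemma ex_strict_mono_through:
  fixes p q a b :: "'a::linordered_field"
  assumes "p < q" "a < b"
  obtains g where "strict_mono g" "g p = a" "g q = b"
proof
  define c where "c = (b - a) / (q - p)"
  have "0 < c" using assms by (simp add: c_def)
  then show "strict_mono (\<lambda>t. a + (t - p) * c)" by (auto simp: strict_mono_def)
  show "a + (p - p) * c = a" by simp
  show "a + (q - p) * c = b" using assms by (simp add: c_def)
qed

lemma ex_between_finite_sets:
  fixes L U :: "'a::{dense_linorder, no_bot, no_top} set"
  assumes "finite L" "finite U" and less: "\<And>l u. l \<in> L \<Longrightarrow> u \<in> U \<Longrightarrow> l < u"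
  shows "\<exists>b. (\<forall>l\<in>L. l < b) \<and> (\<forall>u\<in>U. b < u)"
proof (cases "L = {}")
  case True
  show ?thesis
  proof (cases "U = {}")
    case True
    with \<open>L = {}\<close> show ?thesis by simp
  next
    case False
    obtain b where "b < Min U" using lt_ex by blast
    with \<open>L = {}\<close> \<open>finite U\<close> False show ?thesis by auto
  qed
next
  case L: False
  show ?thesis
  proof (cases "U = {}")
    case True
    obtain b where "Max L < b" using gt_ex by blast
    with True \<open>finite L\<close> L show ?thesis by auto
  next
    case False
    have "Max L < Min U" using assms L False by simp
    then obtain b where "Max L < b" "b < Min U" using dense by blast
    then show ?thesis using assms(1,2) L False by auto
  qed
qed

text \<open>The back-and-forth step: if \<open>a\<close> is a value of \<open>v\<close>, copy the
  corresponding value of \<open>w\<close>; otherwise density and the absence of endpoints give a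
  point in the matching gap. The old values at \<open>k\<close> are overwritten, so nothing is
  required of them.\<close>

lemma order_equiv_extend:
  fixes v w :: "'i \<Rightarrow> 'a::{dense_linorder, no_bot, no_top}"
  assumes "finite S" "order_equiv (S - {k}) v w"
  shows "\<exists>b. order_equiv S (v(k := a)) (w(k := b))"
proof -
  let ?S = "S - {k}"
  have ex: "\<exists>b. \<forall>i\<in>?S. (v i < a \<longleftrightarrow> w i < b) \<and> (a < v i \<longleftrightarrow> b < w i)"
  proof (cases "a \<in> v ` ?S")
    case True
    then obtain j where "j \<in> ?S" "a = v j" by blast
    then show ?thesis using order_equivD[OF assms(2)] by blast
  next
    case False
    let ?L = "w ` {i\<in>?S. v i < a}" and ?U = "w ` {i\<in>?S. a < v i}"
    have less: "l < u" if "l \<in> ?L" "u \<in> ?U" for l u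
    proof -
      obtain i where i: "i \<in> ?S" "v i < a" "l = w i" using \<open>l \<in> ?L\<close> by auto
      obtain j where j: "j \<in> ?S" "a < v j" "u = w j" using \<open>u \<in> ?U\<close> by auto
      have "v i < v j" using i(2) j(2) by (rule order.strict_trans)
      then show ?thesis using order_equivD[OF assms(2) i(1) j(1)] i(3) j(3) by simp
    qed
    have "\<exists>b. (\<forall>l\<in>?L. l < b) \<and> (\<forall>u\<in>?U. b < u)"
    proof (rule ex_between_finite_sets)
      show "finite ?L" "finite ?U" using \<open>finite S\<close> by simp_all
    qed (rule less)
    then obtain b where b: "\<forall>l\<in>?L. l < b" "\<forall>u\<in>?U. b < u" by (elim exE conjE)
    have "v i < a \<and> w i < b \<or> a < v i \<and> b < w i" if "i \<in> ?S" for i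
    proof -
      have "v i \<noteq> a" using False that by blast
      then consider "v i < a" | "a < v i" by (rule linorder_neqE)
      then show ?thesis using b that by cases simp_all
    qed
    then show ?thesis using less_asym by metis
  qed
  then obtain b where "\<forall>i\<in>?S. (v i < a \<longleftrightarrow> w i < b) \<and> (a < v i \<longleftrightarrow> b < w i)" ..
  then have "order_equiv S (v(k := a)) (w(k := b))"
    using assms(2) by (auto simp: order_equiv_def)
  then show ?thesis ..
qed

section \<open>Invariance of first-order formulas under order equivalence\<close>

lemma finite_atom_vars: "finite (atom_vars p)"
  by (cases p) auto

lemma finite_free_vars: "finite (free_vars \<phi>)"
  by (induction \<phi>) (auto simp: finite_atom_vars)

text \<open>An Ehrenfeucht-Fraisse argument: a witness for a quantifier is transferred by
  \<open>order_equiv_extend\<close>, which applies because a formula has finitely many free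
  variables.\<close>

lemma sat_order_equiv:
  assumes "wf_fm rat_order \<phi>" "order_equiv (free_vars \<phi>) v w"
  shows "sat rat_order v \<phi> \<longleftrightarrow> sat rat_order w \<phi>"
  using assms
proof (induction \<phi> arbitrary: v w)
  case (Atom p)
  show ?case
  proof (cases p)
    case (Rel s "is")
    with Atom have "length is = 2" by (simp add: rat_order_def)
    then obtain i j where "is = [i, j]" by (auto simp: numeral_2_eq_2 length_Suc_conv)
    then show ?thesis using Rel Atom order_equivD[of _ v w i j] by (simp add: rat_order_def)
  next
    case (Eq i j)
    then show ?thesis using Atom order_equiv_eqD[of _ v w i j] by simp
  qed
next
  case (Neg \<phi>)
  then show ?case by simp
next
  case (Conj \<phi> \<psi>)
  have "order_equiv (free_vars \<phi>) v w" "order_equiv (free_vars \<psi>) v w"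
    using Conj.prems(2) by (auto elim: order_equiv_subset)
  then show ?case using Conj.IH Conj.prems(1) by simp
next
  case (Ex k \<phi>)
  have imp: "sat rat_order w' (Ex k \<phi>)"
    if eq: "order_equiv (free_vars (Ex k \<phi>)) v' w'" and sat: "sat rat_order v' (Ex k \<phi>)" for v' w'
  proof -
    obtain a where a: "sat rat_order (v'(k := a)) \<phi>" using sat by auto
    have "order_equiv (free_vars \<phi> - {k}) v' w'" using eq by simp
    from order_equiv_extend[OF finite_free_vars this]
    obtain b where b: "order_equiv (free_vars \<phi>) (v'(k := a)) (w'(k := b))" by (rule exE)
    have "wf_fm rat_order \<phi>" using Ex.prems(1) by simp
    from Ex.IH[OF this b] a have "sat rat_order (w'(k := b)) \<phi>" by (rule iffD1)
    then show ?thesis by auto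
  qed
  show ?case using imp[OF Ex.prems(2)] imp[OF order_equiv_sym[OF Ex.prems(2)]] by (rule iffI)
qed

lemma fo_definable_order_equiv:
  assumes "fo_definable rat_order n R" "map v [0..<n] \<in> R" "order_equiv {..<n} v w"
  shows "map w [0..<n] \<in> R"
proof -
  obtain \<phi> where \<phi>: "wf_fm rat_order \<phi>" "free_vars \<phi> \<subseteq> {..<n}"
      and R: "R = {xs. length xs = n \<and> sat rat_order (nth xs) \<phi>}"
    using assms(1) by (auto simp: fo_definable_def)
  have "order_equiv {..<n} (nth (map v [0..<n])) (nth (map w [0..<n]))"
    using assms(3) by (simp add: order_equiv_def)
  from sat_order_equiv[OF \<phi>(1) order_equiv_subset[OF this \<phi>(2)]]
  show ?thesis using assms(2) by (simp add: R)
qed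


section \<open>Relations closed under \<open>mx\<close>\<close>

definition minset :: "'i set \<Rightarrow> ('i \<Rightarrow> 'a::linorder) \<Rightarrow> 'i set" where
  "minset S v = {i\<in>S. \<forall>j\<in>S. v i \<le> v j}"

lemma minset_subset: "minset S v \<subseteq> S"
  by (auto simp: minset_def)

lemma minsetD: "i \<in> minset S v \<Longrightarrow> i \<in> S"
  by (simp add: minset_def)

lemma minset_nonempty:
  assumes "finite S" "S \<noteq> {}"
  shows "minset S v \<noteq> {}"
proof -
  obtain i where "i \<in> S" "\<forall>j\<in>S. v i \<le> v j"
    using arg_min_if_finite[OF assms, of v] by (metis not_le)
  then have "i \<in> minset S v" by (simp add: minset_def)
  then show ?thesis by blast
qed

lemma minset_le: "i \<in> minset S v \<Longrightarrow> k \<in> S \<Longrightarrow> v i \<le> v k"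
  by (simp add: minset_def)

lemma minset_eqI:
  assumes "i \<in> C" "C \<subseteq> S" and eq: "\<And>j. j \<in> C \<Longrightarrow> v j = v i"
    and less: "\<And>j. j \<in> S - C \<Longrightarrow> v i < v j"
  shows "minset S v = C"
proof (rule set_eqI)
  have le: "v i \<le> v j" if "j \<in> S" for j
    using that eq[of j] less[of j] by (cases "j \<in> C") (simp_all add: less_imp_le)
  fix k
  show "k \<in> minset S v \<longleftrightarrow> k \<in> C"
  proof
    assume "k \<in> minset S v"
    then have "k \<in> S" "v k \<le> v i" using assms(1,2) by (auto simp: minset_def)
    then show "k \<in> C" using less[of k] by (cases "k \<in> C") simp_all
  next
    assume "k \<in> C"
    then show "k \<in> minset S v" using le eq[of k] assms(2) by (auto simp: minset_def)
  qed
qed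

lemma minset_eqD: "i \<in> minset S v \<Longrightarrow> j \<in> minset S v \<Longrightarrow> v i = v j"
  by (simp add: minset_def order_antisym)

lemma minset_lessD:
  assumes "i \<in> minset S v" "j \<in> S - minset S v"
  shows "v i < v j"
proof (rule ccontr)
  assume "\<not> v i < v j"
  then have "v j \<le> v k" if "k \<in> S" for k
    using minset_le[OF assms(1) that] by simp
  then show False using assms(2) by (simp add: minset_def)
qed

text \<open>The minimum of \<open>v\<close> lies below all of \<open>w\<close> on \<open>S\<close>,
  so only \<open>v\<close> decides where the pointwise minimum is smallest.\<close>

lemma minset_min_less:
  fixes v w :: "'i \<Rightarrow> 'a::linorder"
  assumes "i \<in> minset S v" "j \<in> minset S w" "v i < w j"
  shows "minset S (\<lambda>i. min (v i) (w i)) = minset S v"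
proof (rule minset_eqI[OF assms(1) minset_subset])
  have less: "v i < w k" if "k \<in> S" for k
    using minset_le[OF assms(2) that] assms(3) by simp
  have "i \<in> S" using assms(1) by (rule minsetD)
  then have min_i: "min (v i) (w i) = v i" using less by (simp add: less_imp_le)
  show "min (v k) (w k) = min (v i) (w i)" if "k \<in> minset S v" for k
  proof -
    have "k \<in> S" "v k = v i" using minsetD[OF that] minset_eqD[OF that assms(1)] .
    then show ?thesis using less min_i by (simp add: less_imp_le)
  qed
  show "min (v i) (w i) < min (v k) (w k)" if "k \<in> S - minset S v" for k
    using minset_lessD[OF assms(1) that] less that by (simp add: min_i)
qed

text \<open>Both tuples have the same minimum on \<open>S\<close>, and the pointwise minimum attains
  it wherever at least one of them does.\<close>

lemma minset_min_eq:
  fixes v w :: "'i \<Rightarrow> 'a::linorder"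
  assumes "i \<in> minset S v" "j \<in> minset S w" "v i = w j"
  shows "minset S (\<lambda>i. min (v i) (w i)) = minset S v \<union> minset S w"
proof -
  have le: "v i \<le> min (v k) (w k)" if "k \<in> S" for k
    using minset_le[OF assms(1) that] minset_le[OF assms(2) that] assms(3) by simp
  have v: "v k = v i" if "k \<in> minset S v" for k
    using minset_eqD[OF that assms(1)] .
  have w: "w k = v i" if "k \<in> minset S w" for k
    using minset_eqD[OF that assms(2)] assms(3) by simp
  have eq: "min (v k) (w k) = v i" if "k \<in> minset S v \<union> minset S w" for k
  proof (rule antisym)
    show "min (v k) (w k) \<le> v i" using that v[of k] w[of k] by (auto simp: min_le_iff_disj)
    show "v i \<le> min (v k) (w k)" using that le minsetD[of k S v] minsetD[of k S w] by blast
  qed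
  show ?thesis
  proof (rule minset_eqI[of i])
    show "min (v k) (w k) = min (v i) (w i)" if "k \<in> minset S v \<union> minset S w" for k
      using eq that assms(1) by simp
    show "min (v i) (w i) < min (v k) (w k)" if k: "k \<in> S - (minset S v \<union> minset S w)" for k
    proof -
      have "v i < v k" "w j < w k"
        using k minset_lessD[OF assms(1), of k] minset_lessD[OF assms(2), of k] by blast+
      then show ?thesis using eq[of i] assms by simp
    qed
    show "i \<in> minset S v \<union> minset S w" using assms(1) by simp
    show "minset S v \<union> minset S w \<subseteq> S" using minset_subset[of S v] minset_subset[of S w] by simp
  qed
qed

text \<open>Hence a missing union of two minimal sets is the only possible obstruction to closure
  under \<open>min\<close>.\<close>

lemma minset_min:
  fixes v w :: "'i \<Rightarrow> 'a::linorder"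
  assumes "finite S" "S \<noteq> {}"
  shows "minset S (\<lambda>i. min (v i) (w i)) \<in> {minset S v, minset S w, minset S v \<union> minset S w}"
proof -
  obtain i j where i: "i \<in> minset S v" and j: "j \<in> minset S w"
    using minset_nonempty[OF assms] by (metis ex_in_conv)
  consider "v i < w j" | "w j < v i" | "v i = w j" by fastforce
  then show ?thesis
  proof cases
    case 2
    then show ?thesis using minset_min_less[OF j i] by (simp add: min.commute)
  qed (use minset_min_less[OF i j] minset_min_eq[OF i j] in simp_all)
qed

section \<open>Minimal sets under closure by \<open>mx\<close>\<close>

lemma mx_less: "x < y \<Longrightarrow> mx \<alpha> \<beta> x y = \<alpha> x"
  and mx_greater: "y < x \<Longrightarrow> mx \<alpha> \<beta> x y = \<alpha> y"
  and mx_same: "mx \<alpha> \<beta> x x = \<beta> x"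
  by (simp_all add: mx_def)

text \<open>Membership in a relation becomes a predicate \<open>P\<close> on valuations of the
  coordinate set \<open>I\<close>. By \<open>order_equiv_closed\<close>, values outside
  \<open>I\<close> do not matter, and a tuple may be replaced by any other of the same order
  type.\<close>

locale mx_closed =
  fixes \<alpha> \<beta> :: "rat \<Rightarrow> rat" and I :: "'i set" and P :: "('i \<Rightarrow> rat) \<Rightarrow> bool"
  assumes strict_mono_alpha: "strict_mono \<alpha>"
    and alpha_less_beta: "\<alpha> x < \<beta> x"
    and beta_less_alpha: "x < y \<Longrightarrow> \<beta> x < \<alpha> y"
    and finite_I: "finite I"
    and order_equiv_closed: "P v \<Longrightarrow> order_equiv I v w \<Longrightarrow> P w"
    and mx_closed: "P v \<Longrightarrow> P w \<Longrightarrow> P (\<lambda>i. mx \<alpha> \<beta> (v i) (w i))"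
begin

lemma beta_less_mx: "m < x \<Longrightarrow> m < y \<Longrightarrow> \<beta> m < mx \<alpha> \<beta> x y"
  using beta_less_alpha alpha_less_beta by (simp add: mx_def) (metis min_def order.strict_trans)

lemma strict_mono_closed: "P v \<Longrightarrow> strict_mono g \<Longrightarrow> P (\<lambda>i. g (v i))"
  using order_equiv_closed order_equiv_strict_mono by blast

text \<open>
  Stretching \<open>v\<close> so that its minimum lies below all of \<open>w\<close> and its other values above all of \<open>w\<close>
  makes \<open>mx\<close> constant on the minimal set of \<open>v\<close>, while it follows \<open>w\<close> elsewhere.
\<close>

lemma combine:
  assumes "P v" "P w" and S: "S \<subseteq> I" "S \<noteq> {}"
  obtains u where "P u" "minset S u = minset S v" "order_equiv (S - minset S v) u w"
proof -
  have fin: "finite S" using S(1) finite_I by (rule finite_subset)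
  obtain i where i: "i \<in> minset S v" using minset_nonempty[OF fin S(2), of v] by blast
  define m where "m = v i"
  \<comment> \<open>All values of \<open>w\<close> on \<open>S\<close> lie strictly between
    \<open>m - K\<close> and \<open>m + K\<close>; the summand 1 makes this strict. The map
    \<open>g\<close> below opens this gap by moving the minimum of \<open>v\<close> down and
    everything larger up.\<close>
  define K where "K = (\<Sum>j\<in>S. \<bar>w j - m\<bar>) + 1"
  have K: "\<bar>w j - m\<bar> < K" if "j \<in> S" for j
    using member_le_sum[of j S "\<lambda>j. \<bar>w j - m\<bar>"] that fin by (simp add: K_def)
  have "0 < K" by (simp add: K_def sum_nonneg add_nonneg_pos)
  define g where "g x = (if x \<le> m then x - K else x + K)" for x
  have "strict_mono g" using \<open>0 < K\<close> by (auto simp: strict_mono_def g_def)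
  define u where "u j = mx \<alpha> \<beta> (g (v j)) (w j)" for j
  have "P u"
    unfolding u_def using mx_closed strict_mono_closed assms(1,2) \<open>strict_mono g\<close> by blast
  have low: "u j = \<alpha> (m - K)" if "j \<in> minset S v" for j
  proof -
    have "v j = m" "j \<in> S" using minset_eqD[OF that i] minsetD[OF that] by (simp_all add: m_def)
    then show ?thesis using K[of j] by (simp add: u_def g_def mx_less)
  qed
  have high: "u j = \<alpha> (w j)" "m - K < w j" if "j \<in> S - minset S v" for j
  proof -
    have "m < v j" using minset_lessD[OF i that] by (simp add: m_def)
    then show "u j = \<alpha> (w j)" "m - K < w j"
      using K[of j] that by (simp_all add: u_def g_def mx_greater)
  qed
  have less: "\<alpha> x < \<alpha> y \<longleftrightarrow> x < y" for x y
    using strict_mono_less[OF strict_mono_alpha] .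
  have "minset S u = minset S v"
    using i low high by (intro minset_eqI[OF i minset_subset]) (simp_all add: less)
  moreover have "order_equiv (S - minset S v) u w"
    by (simp add: order_equiv_def high less)
  ultimately show ?thesis using that \<open>P u\<close> by blast
qed

text \<open>This is addition in the vector space of minimal sets. Once both minima equal
  \<open>m\<close>, \<open>mx\<close> yields \<open>\<alpha> m\<close> where exactly one tuple is
  minimal, \<open>\<beta> m\<close> where both are, and more than \<open>\<beta> m\<close>
  elsewhere. Equal sets would sum to the empty set, which is no minimal set.\<close>

lemma minset_symmetric_difference:
  assumes "P v" "P w" and S: "S \<subseteq> I" "S \<noteq> {}" and neq: "minset S v \<noteq> minset S w"
  obtains u where "P u" "minset S u = (minset S v - minset S w) \<union> (minset S w - minset S v)"
proof -
  have fin: "finite S" using S(1) finite_I by (rule finite_subset)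
  obtain i j where i: "i \<in> minset S v" and j: "j \<in> minset S w"
    using minset_nonempty[OF fin S(2)] by (metis ex_in_conv)
  define m where "m = v i"
  \<comment> \<open>Translating \<open>w\<close> gives both tuples the minimum \<open>m\<close> on
    \<open>S\<close>.\<close>
  define w' where "w' k = w k + (m - w j)" for k
  define u where "u k = mx \<alpha> \<beta> (v k) (w' k)" for k
  have "P w'" unfolding w'_def
    by (rule strict_mono_closed[OF \<open>P w\<close>]) (simp add: strict_mono_def)
  then have "P u" unfolding u_def using mx_closed \<open>P v\<close> by blast
  have v: "v k = m" if "k \<in> minset S v" for k
    using minset_eqD[OF that i] by (simp add: m_def)
  have w: "w' k = m" if "k \<in> minset S w" for k
    using minset_eqD[OF that j] by (simp add: w'_def)
  have v': "m < v k" if "k \<in> S - minset S v" for k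
    using minset_lessD[OF i that] by (simp add: m_def)
  have w': "m < w' k" if "k \<in> S - minset S w" for k
    using minset_lessD[OF j that] by (simp add: w'_def)
  let ?D = "(minset S v - minset S w) \<union> (minset S w - minset S v)"
  have D: "u k = \<alpha> m" if "k \<in> ?D" for k
    using that v[of k] w[of k] v'[of k] w'[of k] minsetD[of k S v] minsetD[of k S w]
    by (auto simp: u_def mx_less mx_greater)
  have not_D: "\<alpha> m < u k" if "k \<in> S - ?D" for k
  proof (cases "k \<in> minset S v")
    case True
    then show ?thesis using that v[of k] w[of k] alpha_less_beta by (simp add: u_def mx_same)
  next
    case False
    then have "\<beta> m < u k" unfolding u_def using that v'[of k] w'[of k] beta_less_mx by simp
    then show ?thesis using alpha_less_beta order.strict_trans by blast
  qed
  obtain k where "k \<in> ?D" using neq by blast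
  moreover have "?D \<subseteq> S" using minset_subset[of S v] minset_subset[of S w] by blast
  ultimately have "minset S u = ?D"
    using D not_D by (intro minset_eqI[of k]) simp_all
  then show ?thesis using that \<open>P u\<close> by blast
qed

text \<open>The order type of \<open>t\<close> is rebuilt level by level: a member with the right
  minimal set is glued by \<open>combine\<close> to one that is already correct on the remaining
  coordinates.\<close>

lemma minsets_determine:
  assumes "\<exists>v. P v" and minsets: "\<And>S. S \<subseteq> I \<Longrightarrow> S \<noteq> {} \<Longrightarrow> \<exists>v. P v \<and> minset S v = minset S t"
  shows "P t"
proof -
  have "\<exists>v. P v \<and> order_equiv S v t" if "finite S" "S \<subseteq> I" for S
    using that
  proof (induction S rule: finite_psubset_induct)
    case (psubset S)
    show ?case
    proof (cases "S = {}")
      case True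
      then show ?thesis using assms(1) by (simp add: order_equiv_def)
    next
      case False
      let ?C = "minset S t"
      obtain v where v: "P v" "minset S v = ?C" using minsets psubset.prems False by blast
      have C: "?C \<subseteq> S" "?C \<noteq> {}" using minset_subset[of S t] minset_nonempty[OF psubset.hyps False] .
      \<comment> \<open>The induction removes the lowest level of \<open>t\<close>, which is
        nonempty.\<close>
      then have "S - ?C \<subset> S" by blast
      then obtain w where w: "P w" "order_equiv (S - ?C) w t"
        using psubset.IH[of "S - ?C"] psubset.prems by auto
      obtain u where u: "P u" "minset S u = ?C" "order_equiv (S - ?C) u w"
        using combine[OF v(1) w(1) psubset.prems False] v(2) by metis
      have rest: "order_equiv (S - ?C) u t" using order_equiv_trans[OF u(3) w(2)] .
      have "u i < u j \<longleftrightarrow> t i < t j" if "i \<in> S" "j \<in> S" for i j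
      proof (cases "i \<in> ?C")
        case True
        then show ?thesis
          using that u(2) minset_eqD[of _ S] minset_lessD[of _ S] by (metis DiffI less_irrefl)
      next
        case False
        then show ?thesis
          using that u(2) rest minset_lessD[of _ S] order_equivD[of "S - ?C" u t]
          by (metis DiffI less_asym)
      qed
      then show ?thesis using u(1) by (auto simp: order_equiv_def)
    qed
  qed
  then show ?thesis using order_equiv_closed finite_I by blast
qed

text \<open>On a minimal \<open>S\<close> without constant tuples, \<open>combine\<close> yields a
  tuple with exactly two levels, and rescaling gives all pairs \<open>x < y\<close>. Equality would
  be a constant tuple on \<open>S\<close>; a reversed pair would produce one through
  \<open>mx\<close>.\<close>

lemma defines_less:
  assumes "\<exists>v. P v" "\<not> P (\<lambda>_. 0)"
  obtains S C where "S \<subseteq> I" "C \<subseteq> S"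
    "\<forall>x y. (\<exists>u. P u \<and> (\<forall>i\<in>C. u i = x) \<and> (\<forall>i\<in>S - C. u i = y)) \<longleftrightarrow> x < y"
proof -
  define const_on where "const_on S \<longleftrightarrow> (\<exists>u c. P u \<and> (\<forall>i\<in>S. u i = c))" for S
  \<comment> \<open>Every tuple constant on \<open>I\<close> has the order type of the zero
    tuple.\<close>
  have "\<not> const_on I"
    unfolding const_on_def using order_equiv_closed assms(2) by (fastforce simp: order_equiv_def)
  define F where "F = {S \<in> Pow I. \<not> const_on S}"
  have "I \<in> F" using \<open>\<not> const_on I\<close> by (simp add: F_def)
  then have "F \<noteq> {}" by blast
  have "finite F" using finite_I by (simp add: F_def)
  obtain S where "S \<in> F" and F_min: "\<forall>T\<in>F. T \<subseteq> S \<longrightarrow> S = T"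
    using finite_has_minimal[OF \<open>finite F\<close> \<open>F \<noteq> {}\<close>] by (rule bexE)
  have S: "S \<subseteq> I" "\<not> const_on S" using \<open>S \<in> F\<close> by (simp_all add: F_def)
  have minimal: "const_on T" if "T \<subset> S" for T
  proof (rule ccontr)
    assume "\<not> const_on T"
    then have "T \<in> F" using that S(1) by (simp add: F_def)
    then show False using F_min that by auto
  qed
  obtain v where "P v" using assms(1) by blast
  define C where "C = minset S v"
  have "S \<noteq> {}" using S(2) \<open>P v\<close> by (auto simp: const_on_def)
  have "finite S" using S(1) finite_I by (rule finite_subset)
  then have C: "C \<subseteq> S" "C \<noteq> {}"
    using minset_subset[of S v] minset_nonempty[OF _ \<open>S \<noteq> {}\<close>] by (simp_all add: C_def)
  have "C \<noteq> S" using S(2) \<open>P v\<close> minset_eqD[of _ S v] by (metis C_def const_on_def)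
  \<comment> \<open>Since \<open>C\<close> is nonempty, minimality of \<open>S\<close> applies to
    \<open>S - C\<close>.\<close>
  obtain w c where "P w" and w: "\<forall>i\<in>S - C. w i = c"
    using minimal[of "S - C"] C by (auto simp: const_on_def)
  obtain u where u: "P u" "minset S u = C" "order_equiv (S - C) u w"
    using combine[OF \<open>P v\<close> \<open>P w\<close> S(1) \<open>S \<noteq> {}\<close>] C_def by metis
  obtain p q where p: "p \<in> C" and q: "q \<in> S - C" using C \<open>C \<noteq> S\<close> by blast
  have u_C: "u i = u p" if "i \<in> C" for i using minset_eqD u(2) that p by metis
  have u_q: "u i = u q" if "i \<in> S - C" for i
    using order_equiv_eqD[OF u(3) that q] w that q by simp
  have "u p < u q" using minset_lessD u(2) p q by metis
  let ?T = "\<lambda>x y. \<exists>u. P u \<and> (\<forall>i\<in>C. u i = x) \<and> (\<forall>i\<in>S - C. u i = y)"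
  have less: "?T x y" if "x < y" for x y
  proof -
    obtain g where g: "strict_mono g" "g (u p) = x" "g (u q) = y"
      using ex_strict_mono_through[OF \<open>u p < u q\<close> \<open>x < y\<close>] .
    then have "P (\<lambda>i. g (u i))" using strict_mono_closed u(1) by blast
    then show ?thesis using u_C u_q g(2,3) by (intro exI[of _ "\<lambda>i. g (u i)"]) simp
  qed
  have not_same: "\<not> ?T x x" for x
  proof
    assume "?T x x"
    then obtain u where "P u" "\<forall>i\<in>S. u i = x" by blast
    then show False using S(2) unfolding const_on_def by blast
  qed
  have not_greater: "\<not> ?T x y" if "y < x" for x y
  proof
    assume "?T x y"
    then obtain s where s: "P s" "\<forall>i\<in>C. s i = x" "\<forall>i\<in>S - C. s i = y" by blast
    obtain t where t: "P t" "\<forall>i\<in>C. t i = y" "\<forall>i\<in>S - C. t i = x" using less[OF \<open>y < x\<close>] by blast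
    \<comment> \<open>On each coordinate of \<open>S\<close> the arguments are \<open>x\<close> and
      \<open>y\<close> in some order, so \<open>mx\<close> always returns
      \<open>\<alpha> y\<close>.\<close>
    let ?u = "\<lambda>i. mx \<alpha> \<beta> (s i) (t i)"
    have "P ?u" using mx_closed s(1) t(1) by blast
    moreover have "?u i = \<alpha> y" if "i \<in> S" for i
      using s t that \<open>y < x\<close> by (cases "i \<in> C") (simp_all add: mx_less mx_greater)
    ultimately show False using S(2) unfolding const_on_def by blast
  qed
  have "\<forall>x y. ?T x y \<longleftrightarrow> x < y"
    using less not_same not_greater by (metis linorder_neqE)
  then show ?thesis by (rule that[OF S(1) C(1)])
qed

text \<open>On the blocks \<open>A\<close>, \<open>B\<close>, \<open>C\<close> the patterns 110, 101
  and 011 occur as minimal sets. Any other nonempty pattern is 111 or sums with one of these to 111,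
  which is the missing union. The condition on \<open>D\<close> keeps those coordinates out of the
  minimal set.\<close>

lemma defines_X:
  assumes "P v" "P w" "\<not> P (\<lambda>i. min (v i) (w i))"
  obtains A B C D where "A \<subseteq> I" "B \<subseteq> I" "C \<subseteq> I" "D \<subseteq> I"
    "\<forall>x y z. (\<exists>u. P u \<and> (\<forall>i\<in>A. u i = x) \<and> (\<forall>i\<in>B. u i = y) \<and> (\<forall>i\<in>C. u i = z) \<and> (\<forall>i\<in>D. x < u i))
       \<longleftrightarrow> (x = y \<and> y < z) \<or> (y = z \<and> z < x) \<or> (z = x \<and> x < y)"
proof -
  \<comment> \<open>The contrapositive of \<open>minsets_determine\<close>; by
    \<open>minset_min\<close>, the minimal set missing on \<open>S\<close> must then be the union
    \<open>E \<union> F\<close>.\<close>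
  obtain S where S: "S \<subseteq> I" "S \<noteq> {}"
      and not_min: "\<And>u. P u \<Longrightarrow> minset S u \<noteq> minset S (\<lambda>i. min (v i) (w i))"
    using minsets_determine assms by metis
  have fin: "finite S" using S(1) finite_I by (rule finite_subset)
  define E F where "E = minset S v" and "F = minset S w"
  have "minset S (\<lambda>i. min (v i) (w i)) = E \<union> F"
    using minset_min[OF fin S(2), of v w] not_min assms(1,2) by (auto simp: E_def F_def)
  then have not_Un: "minset S u \<noteq> E \<union> F" if "P u" for u using not_min that by simp
  have sub: "E \<subseteq> S" "F \<subseteq> S" by (simp_all add: E_def F_def minset_subset)
  define A B C D where "A = E \<inter> F" and "B = E - F" and "C = F - E" and "D = S - (E \<union> F)"
  note defs = A_def B_def C_def D_def
  \<comment> \<open>The source of all later contradictions: two distinct minimal sets must not add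
    up to \<open>E \<union> F\<close>.\<close>
  have sym_diff: "False"
    if "P s" "P t" "minset S s = G" "minset S t = H" "G \<noteq> H" "(G - H) \<union> (H - G) = E \<union> F" for s t G H
    using minset_symmetric_difference[OF that(1,2) S] that not_Un by metis
  have "E \<noteq> F" using not_Un[OF assms(1)] by (auto simp: E_def F_def)
  \<comment> \<open>Disjoint \<open>E\<close> and \<open>F\<close> would have their union as
    symmetric difference; if \<open>B\<close> or \<open>C\<close> were empty, the union would be
    \<open>F\<close> or \<open>E\<close> itself.\<close>
  have A: "A \<noteq> {}"
    using sym_diff[OF assms(1,2) refl refl] \<open>E \<noteq> F\<close> unfolding A_def E_def F_def by blast
  have B: "B \<noteq> {}" using not_Un[OF assms(2)] by (auto simp: B_def E_def F_def)
  have C: "C \<noteq> {}" using not_Un[OF assms(1)] by (auto simp: C_def E_def F_def)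
  obtain t where "P t" and t: "minset S t = B \<union> C"
    using minset_symmetric_difference[OF assms(1,2) S] \<open>E \<noteq> F\<close> unfolding B_def C_def E_def F_def
    by metis
  let ?T = "\<lambda>x y z. \<exists>u. P u \<and> (\<forall>i\<in>A. u i = x) \<and> (\<forall>i\<in>B. u i = y) \<and> (\<forall>i\<in>C. u i = z) \<and> (\<forall>i\<in>D. x < u i)"
  \<comment> \<open>Gluing \<open>r\<close> below \<open>s\<close> puts \<open>G\<close> at the
    bottom and \<open>H - G\<close>, where \<open>s\<close> is still minimal, on the next level. An
    affine map then sends these two levels to \<open>a\<close> and \<open>b\<close>.\<close>
  have layers: "\<exists>u. P u \<and> (\<forall>i\<in>G. u i = a) \<and> (\<forall>i\<in>H - G. u i = b) \<and> (\<forall>i\<in>S - (G \<union> H). b < u i)"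
    if r: "P r" "minset S r = G" and s: "P s" "minset S s = H" and "\<not> H \<subseteq> G" "a < b"
    for r s G H and a b :: rat
  proof -
    obtain u where u: "P u" "minset S u = G" "order_equiv (S - G) u s"
      using combine[OF r(1) s(1) S] r(2) by metis
    obtain p where p: "p \<in> G" using minset_nonempty[OF fin S(2), of u] u(2) by blast
    obtain q where q: "q \<in> H - G" using \<open>\<not> H \<subseteq> G\<close> by blast
    have HS: "H \<subseteq> S" "G \<subseteq> S"
      using minset_subset[of S r] minset_subset[of S s] r(2) s(2) by simp_all
    have "q \<in> S - minset S u" "p \<in> minset S u" using p q HS u(2) by auto
    then have "u p < u q" using minset_lessD by metis
    have u_G: "u i = u p" if "i \<in> G" for i using minset_eqD u(2) that p by metis
    have u_H: "u i = u q" if "i \<in> H - G" for i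
    proof -
      have "s i = s q" using minset_eqD[of i S s q] that s(2) q by simp
      then show ?thesis using order_equiv_eqD[OF u(3), of i q] that q HS by blast
    qed
    have u_rest: "u q < u i" if "i \<in> S - (G \<union> H)" for i
    proof -
      have "s q < s i" using minset_lessD[of q S s i] that s(2) q by simp
      then show ?thesis using order_equivD[OF u(3), of q i] that q HS by blast
    qed
    obtain g where g: "strict_mono g" "g (u p) = a" "g (u q) = b"
      using ex_strict_mono_through[OF \<open>u p < u q\<close> \<open>a < b\<close>] .
    then have "P (\<lambda>i. g (u i))" using strict_mono_closed u(1) by blast
    moreover have "b < g (u i)" if "i \<in> S - (G \<union> H)" for i
      using strict_monoD[OF g(1) u_rest[OF that]] g(3) by simp
    ultimately show ?thesis using u_G u_H g(2,3) by (intro exI[of _ "\<lambda>i. g (u i)"]) simp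
  qed
  have EF: "E = A \<union> B" "F = A \<union> C" by (auto simp: defs)
  have xy: "?T x y z" if "x = y" "y < z" for x y z
  proof -
    obtain u where "P u" "\<forall>i\<in>E. u i = y" "\<forall>i\<in>F - E. u i = z" "\<forall>i\<in>S - (E \<union> F). z < u i"
      using layers[OF assms(1) E_def[symmetric] assms(2) F_def[symmetric] _ \<open>y < z\<close>] C C_def by blast
    then show ?thesis using that by (intro exI[of _ u]) (auto simp: defs intro: less_trans[of y z])
  qed
  have zx: "?T x y z" if "z = x" "x < y" for x y z
  proof -
    obtain u where "P u" "\<forall>i\<in>F. u i = x" "\<forall>i\<in>E - F. u i = y" "\<forall>i\<in>S - (F \<union> E). y < u i"
      using layers[OF assms(2) F_def[symmetric] assms(1) E_def[symmetric] _ \<open>x < y\<close>] B B_def by blast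
    then show ?thesis using that by (intro exI[of _ u]) (auto simp: defs intro: less_trans[of x y])
  qed
  have yz: "?T x y z" if "y = z" "z < x" for x y z
  proof -
    have "\<not> E \<subseteq> B \<union> C" using A by (auto simp: defs)
    then obtain u where "P u" "\<forall>i\<in>B \<union> C. u i = z" "\<forall>i\<in>E - (B \<union> C). u i = x"
        "\<forall>i\<in>S - ((B \<union> C) \<union> E). x < u i"
      using layers[OF \<open>P t\<close> t assms(1) E_def[symmetric] _ \<open>z < x\<close>] by blast
    then show ?thesis using that by (intro exI[of _ u]) (auto simp: defs)
  qed
  have only_X: "(x = y \<and> y < z) \<or> (y = z \<and> z < x) \<or> (z = x \<and> x < y)" if T: "?T x y z" for x y z
  proof (rule ccontr)
    assume not_X: "\<not> ?thesis"
    obtain u where "P u" and uA: "\<forall>i\<in>A. u i = x" and uB: "\<forall>i\<in>B. u i = y" and uC: "\<forall>i\<in>C. u i = z"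
      and uD: "\<forall>i\<in>D. x < u i" using T by blast
    have S_eq: "S = A \<union> B \<union> C \<union> D" using sub by (auto simp: defs)
    obtain a b c where abc: "a \<in> A" "b \<in> B" "c \<in> C" using A B C by blast
    \<comment> \<open>A triple is in \<open>X\<close> exactly if its minimum is attained twice;
      otherwise it is attained three times or once.\<close>
    have "x = y \<and> y = z \<or> x < y \<and> x < z \<or> y < x \<and> y < z \<or> z < x \<and> z < y"
      using not_X by linarith
    then consider "x = y" "y = z" | "x < y" "x < z" | "y < x" "y < z" | "z < x" "z < y" by blast
    then show False
    proof cases
      case 1
      have "minset S u = E \<union> F"
        using 1 uA uB uC uD abc by (intro minset_eqI[of a]) (auto simp: S_eq EF)
      then show False using not_Un \<open>P u\<close> by blast
    next
      case 2
      have "minset S u = A"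
        using 2 uA uB uC uD abc by (intro minset_eqI[of a]) (auto simp: S_eq)
      then show False using sym_diff[OF \<open>P u\<close> \<open>P t\<close> _ t] abc by (auto simp: defs)
    next
      case 3
      have "minset S u = B"
        using 3 uA uB uC uD abc by (intro minset_eqI[of b]) (auto simp: S_eq intro: less_trans)
      then show False using sym_diff[OF \<open>P u\<close> assms(2) _ F_def[symmetric]] abc by (auto simp: defs)
    next
      case 4
      have "minset S u = C"
        using 4 uA uB uC uD abc by (intro minset_eqI[of c]) (auto simp: S_eq intro: less_trans)
      then show False using sym_diff[OF \<open>P u\<close> assms(1) _ E_def[symmetric]] abc by (auto simp: defs)
    qed
  qed
  have "A \<subseteq> I" "B \<subseteq> I" "C \<subseteq> I" "D \<subseteq> I" using S(1) sub by (auto simp: defs)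
  moreover have "\<forall>x y z. ?T x y z \<longleftrightarrow> (x = y \<and> y < z) \<or> (y = z \<and> z < x) \<or> (z = x \<and> x < y)"
  proof (intro allI iffI)
    fix x y z
    show "(x = y \<and> y < z) \<or> (y = z \<and> z < x) \<or> (z = x \<and> x < y)" if "?T x y z"
      using that by (rule only_X)
    show "?T x y z" if "(x = y \<and> y < z) \<or> (y = z \<and> z < x) \<or> (z = x \<and> x < y)"
      using that by (elim disjE conjE) (rule xy yz zx; assumption)+
  qed
  ultimately show ?thesis by (rule that)
qed

end


section \<open>Primitive positive definability\<close>

primrec rename_atom :: "(nat \<Rightarrow> nat) \<Rightarrow> 's atom \<Rightarrow> 's atom" where
  "rename_atom \<rho> (Rel s is) = Rel s (map \<rho> is)"
| "rename_atom \<rho> (Eq i j) = Eq (\<rho> i) (\<rho> j)"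

lemma atom_vars_rename: "atom_vars (rename_atom \<rho> p) = \<rho> ` atom_vars p"
  by (cases p) auto

lemma wf_rename_atom: "wf_atom B (rename_atom \<rho> p) \<longleftrightarrow> wf_atom B p"
  by (cases p) auto

lemma sat_rename_atom: "sat_atom B v (rename_atom \<rho> p) \<longleftrightarrow> sat_atom B (\<lambda>i. v (\<rho> i)) p"
  by (cases p) (simp_all add: comp_def)

lemma sat_atom_cong:
  assumes "\<And>i. i \<in> atom_vars p \<Longrightarrow> v i = w i"
  shows "sat_atom B v p \<longleftrightarrow> sat_atom B w p"
proof (cases p)
  case (Rel s "is")
  then have "map v is = map w is" using assms by simp
  then show ?thesis by (simp only: Rel sat_atom.simps)
qed (use assms in auto)

text \<open>
  A version of \<open>pp_definable\<close> for predicates on valuations of \<open>0, \<dots>, n - 1\<close>, which avoids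
  concatenating lists.
\<close>

definition pp_pred :: "('s, 'a) relational_structure \<Rightarrow> nat \<Rightarrow> ((nat \<Rightarrow> 'a) \<Rightarrow> bool) \<Rightarrow> bool" where
  "pp_pred B n Q \<longleftrightarrow>
     (\<exists>k ps. (\<forall>p\<in>set ps. wf_atom B p \<and> atom_vars p \<subseteq> {..<n + k}) \<and>
        (\<forall>v. Q v \<longleftrightarrow> (\<exists>w. (\<forall>i<n. w i = v i) \<and> (\<forall>p\<in>set ps. sat_atom B w p))))"

lemma pp_predI:
  assumes "\<And>p. p \<in> set ps \<Longrightarrow> wf_atom B p \<and> atom_vars p \<subseteq> {..<n + k}"
    and "\<And>v. Q v \<longleftrightarrow> (\<exists>w. (\<forall>i<n. w i = v i) \<and> (\<forall>p\<in>set ps. sat_atom B w p))"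
  shows "pp_pred B n Q"
  unfolding pp_pred_def using assms by blast

section \<open>Closure properties of primitive positive predicates\<close>

lemma pp_pred_atom:
  assumes "wf_atom B p" "atom_vars p \<subseteq> {..<n}"
  shows "pp_pred B n (\<lambda>v. sat_atom B v p)"
proof (rule pp_predI[of "[p]" B n 0])
  show "sat_atom B v p \<longleftrightarrow> (\<exists>w. (\<forall>i<n. w i = v i) \<and> (\<forall>p\<in>set [p]. sat_atom B w p))" for v
    using sat_atom_cong[of p] assms(2) by (metis list.set_intros(1) lessThan_iff set_ConsD
      empty_iff list.set(1) subset_eq)
qed (use assms in auto)

lemma pp_pred_True: "pp_pred B n (\<lambda>v. True)"
  by (rule pp_predI[of "[]"]) auto

lemma pp_pred_eq: "i < n \<Longrightarrow> j < n \<Longrightarrow> pp_pred B n (\<lambda>v. v i = v j)"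
  using pp_pred_atom[of B "Eq i j" n] by simp

lemma pp_pred_rel:
  assumes "s \<in> symbols B" "\<And>i. i < arity B s \<Longrightarrow> f i < n"
  shows "pp_pred B n (\<lambda>v. map (\<lambda>i. v (f i)) [0..<arity B s] \<in> interp B s)"
proof -
  have "pp_pred B n (\<lambda>v. sat_atom B v (Rel s (map f [0..<arity B s])))"
    using assms by (intro pp_pred_atom) auto
  moreover have "sat_atom B v (Rel s (map f [0..<arity B s])) \<longleftrightarrow>
      map (\<lambda>i. v (f i)) [0..<arity B s] \<in> interp B s" for v
    by (simp only: sat_atom.simps map_map comp_def)
  ultimately show ?thesis by simp
qed

text \<open>The map \<open>f\<close> may identify or permute variables; applying it to the free
  variables of the atoms performs the substitution.\<close>

lemma pp_pred_subst:
  assumes "pp_pred B n Q" and f: "\<And>i. i < n \<Longrightarrow> f i < m"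
  shows "pp_pred B m (\<lambda>v. Q (\<lambda>i. v (f i)))"
proof -
  obtain ps k where "\<forall>p\<in>set ps. wf_atom B p \<and> atom_vars p \<subseteq> {..<n + k}"
    "\<forall>v. Q v \<longleftrightarrow> (\<exists>w. (\<forall>i<n. w i = v i) \<and> (\<forall>p\<in>set ps. sat_atom B w p))"
    using assms(1) unfolding pp_pred_def by (elim exE conjE)
  note wf = this(1)[rule_format] and Q = this(2)[rule_format]
  \<comment> \<open>Bound variables start at \<open>n\<close> before and at \<open>m\<close> after
    the substitution.\<close>
  define \<rho> where "\<rho> i = (if i < n then f i else m + (i - n))" for i
  show ?thesis
  proof (rule pp_predI[of "map (rename_atom \<rho>) ps" B m k])
    have "\<rho> i < m + k" if "i < n + k" for i
      using that f[of i] by (auto simp: \<rho>_def)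
    then have \<rho>: "\<rho> ` {..<n + k} \<subseteq> {..<m + k}" by auto
    show "wf_atom B p \<and> atom_vars p \<subseteq> {..<m + k}" if p: "p \<in> set (map (rename_atom \<rho>) ps)" for p
    proof -
      obtain q where q: "q \<in> set ps" "p = rename_atom \<rho> q" using p by auto
      have "\<rho> ` atom_vars q \<subseteq> {..<m + k}"
        using subset_trans[OF image_mono \<rho>] wf[OF q(1)] by simp
      then show ?thesis using wf[OF q(1)] by (simp add: q(2) wf_rename_atom atom_vars_rename)
    qed
    fix v
    show "Q (\<lambda>i. v (f i)) \<longleftrightarrow>
        (\<exists>w. (\<forall>i<m. w i = v i) \<and> (\<forall>p\<in>set (map (rename_atom \<rho>) ps). sat_atom B w p))" (is "_ \<longleftrightarrow> ?R")
    proof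
      assume "Q (\<lambda>i. v (f i))"
      then obtain w where w: "\<forall>i<n. w i = v (f i)" "\<forall>p\<in>set ps. sat_atom B w p"
        unfolding Q by (elim exE conjE)
      define w' where "w' i = (if i < m then v i else w (n + (i - m)))" for i
      have "(\<lambda>i. w' (\<rho> i)) = w" using w(1) f by (intro ext) (auto simp: w'_def \<rho>_def)
      then have "\<forall>p\<in>set (map (rename_atom \<rho>) ps). sat_atom B w' p"
        using w(2) by (simp add: sat_rename_atom)
      then show ?R by (intro exI[of _ w'] conjI) (simp add: w'_def)
    next
      assume ?R
      then obtain w where "\<forall>i<m. w i = v i" "\<forall>p\<in>set (map (rename_atom \<rho>) ps). sat_atom B w p"
        by (elim exE conjE)
      then have "\<forall>i<m. w i = v i" "\<forall>p\<in>set ps. sat_atom B (\<lambda>i. w (\<rho> i)) p"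
        by (simp_all add: sat_rename_atom)
      then show "Q (\<lambda>i. v (f i))"
        unfolding Q using f by (intro exI[of _ "\<lambda>i. w (\<rho> i)"]) (simp add: \<rho>_def)
    qed
  qed
qed

text \<open>The atoms stay the same; only the boundary between free and bound variables moves from
  \<open>n + m\<close> to \<open>n\<close>.\<close>

lemma pp_pred_ex:
  assumes "pp_pred B (n + m) Q"
  shows "pp_pred B n (\<lambda>v. \<exists>w. (\<forall>i<n. w i = v i) \<and> Q w)"
proof -
  obtain ps k where "\<forall>p\<in>set ps. wf_atom B p \<and> atom_vars p \<subseteq> {..<n + m + k}"
    "\<forall>v. Q v \<longleftrightarrow> (\<exists>w. (\<forall>i<n + m. w i = v i) \<and> (\<forall>p\<in>set ps. sat_atom B w p))"
    using assms unfolding pp_pred_def by (elim exE conjE)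
  note wf = this(1)[rule_format] and Q = this(2)[rule_format]
  show ?thesis
  proof (rule pp_predI[of ps B n "m + k"])
    show "wf_atom B p \<and> atom_vars p \<subseteq> {..<n + (m + k)}" if "p \<in> set ps" for p
      using wf[OF that] by (simp add: add.assoc)
    show "(\<exists>w. (\<forall>i<n. w i = v i) \<and> Q w) \<longleftrightarrow> (\<exists>w. (\<forall>i<n. w i = v i) \<and> (\<forall>p\<in>set ps. sat_atom B w p))" for v
    proof
      assume "\<exists>w. (\<forall>i<n. w i = v i) \<and> Q w"
      then obtain w where w: "\<forall>i<n. w i = v i" "Q w" by (elim exE conjE)
      then obtain w' where "\<forall>i<n + m. w' i = w i" "\<forall>p\<in>set ps. sat_atom B w' p"
        unfolding Q by (elim exE conjE)
      then show "\<exists>w. (\<forall>i<n. w i = v i) \<and> (\<forall>p\<in>set ps. sat_atom B w p)"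
        using w(1) by (intro exI[of _ w']) simp
    next
      assume "\<exists>w. (\<forall>i<n. w i = v i) \<and> (\<forall>p\<in>set ps. sat_atom B w p)"
      then obtain w where w: "\<forall>i<n. w i = v i" "\<forall>p\<in>set ps. sat_atom B w p" by (elim exE conjE)
      then have "Q w" unfolding Q by (intro exI[of _ w]) simp
      then show "\<exists>w. (\<forall>i<n. w i = v i) \<and> Q w" using w(1) by (intro exI[of _ w]) simp
    qed
  qed
qed

lemma pp_pred_conj:
  assumes "pp_pred B n Q1" "pp_pred B n Q2"
  shows "pp_pred B n (\<lambda>v. Q1 v \<and> Q2 v)"
proof -
  obtain ps1 k1 where "\<forall>p\<in>set ps1. wf_atom B p \<and> atom_vars p \<subseteq> {..<n + k1}"
    "\<forall>v. Q1 v \<longleftrightarrow> (\<exists>w. (\<forall>i<n. w i = v i) \<and> (\<forall>p\<in>set ps1. sat_atom B w p))"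
    using assms(1) unfolding pp_pred_def by (elim exE conjE)
  note wf1 = this(1)[rule_format] and Q1 = this(2)[rule_format]
  obtain ps2 k2 where "\<forall>p\<in>set ps2. wf_atom B p \<and> atom_vars p \<subseteq> {..<n + k2}"
    "\<forall>v. Q2 v \<longleftrightarrow> (\<exists>w. (\<forall>i<n. w i = v i) \<and> (\<forall>p\<in>set ps2. sat_atom B w p))"
    using assms(2) unfolding pp_pred_def by (elim exE conjE)
  note wf2 = this(1)[rule_format] and Q2 = this(2)[rule_format]
  \<comment> \<open>The bound variables of the second formula are shifted past the \<open>k1\<close>
    bound variables of the first, so that their witnesses can be chosen independently.\<close>
  define \<rho> where "\<rho> i = (if i < n then i else i + k1)" for i
  let ?ps = "ps1 @ map (rename_atom \<rho>) ps2"
  show ?thesis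
  proof (rule pp_predI[of ?ps B n "k1 + k2"])
    have "\<rho> i < n + (k1 + k2)" if "i < n + k2" for i
      using that by (auto simp: \<rho>_def)
    then have \<rho>: "\<rho> ` {..<n + k2} \<subseteq> {..<n + (k1 + k2)}" by auto
    show "wf_atom B p \<and> atom_vars p \<subseteq> {..<n + (k1 + k2)}" if p: "p \<in> set ?ps" for p
    proof (cases "p \<in> set ps1")
      case True
      have "{..<n + k1} \<subseteq> {..<n + (k1 + k2)}" by simp
      then show ?thesis using wf1[OF True] by (simp add: subset_trans[of _ "{..<n + k1}"])
    next
      case False
      then obtain q where q: "q \<in> set ps2" "p = rename_atom \<rho> q" using p by auto
      have "\<rho> ` atom_vars q \<subseteq> {..<n + (k1 + k2)}"
        using subset_trans[OF image_mono \<rho>] wf2[OF q(1)] by simp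
      then show ?thesis using wf2[OF q(1)] by (simp add: q(2) wf_rename_atom atom_vars_rename)
    qed
    fix v
    show "Q1 v \<and> Q2 v \<longleftrightarrow> (\<exists>w. (\<forall>i<n. w i = v i) \<and> (\<forall>p\<in>set ?ps. sat_atom B w p))" (is "_ \<longleftrightarrow> ?R")
    proof
      assume "Q1 v \<and> Q2 v"
      then obtain w1 w2 where w1: "\<forall>i<n. w1 i = v i" "\<forall>p\<in>set ps1. sat_atom B w1 p"
        and w2: "\<forall>i<n. w2 i = v i" "\<forall>p\<in>set ps2. sat_atom B w2 p"
        unfolding Q1 Q2 by (elim exE conjE)
      define w where "w i = (if i < n + k1 then w1 i else w2 (i - k1))" for i
      have "sat_atom B w p" if "p \<in> set ps1" for p
      proof -
        have "sat_atom B w p \<longleftrightarrow> sat_atom B w1 p"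
          using wf1[OF that] by (intro sat_atom_cong) (auto simp: w_def)
        then show ?thesis using w1(2) that by blast
      qed
      moreover
      have "(\<lambda>i. w (\<rho> i)) = w2"
        using w1(1) w2(1) by (intro ext) (auto simp: w_def \<rho>_def)
      then have "\<forall>p\<in>set (map (rename_atom \<rho>) ps2). sat_atom B w p"
        using w2(2) by (simp add: sat_rename_atom)
      ultimately have "\<forall>p\<in>set ?ps. sat_atom B w p" by auto
      then show ?R using w1(1) by (intro exI[of _ w] conjI) (simp add: w_def)
    next
      assume ?R
      then obtain w where w: "\<forall>i<n. w i = v i" "\<forall>p\<in>set ?ps. sat_atom B w p" by (elim exE conjE)
      have ps: "\<forall>p\<in>set ps1. sat_atom B w p" "\<forall>p\<in>set ps2. sat_atom B (\<lambda>i. w (\<rho> i)) p"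
        using w(2) by (simp_all add: sat_rename_atom ball_Un)
      have "\<forall>i<n. w (\<rho> i) = v i" using w(1) by (simp add: \<rho>_def)
      then have "Q2 v" unfolding Q2 using ps(2) by (intro exI[of _ "\<lambda>i. w (\<rho> i)"]) simp
      moreover have "Q1 v" unfolding Q1 using w(1) ps(1) by (intro exI[of _ w]) simp
      ultimately show "Q1 v \<and> Q2 v" by simp
    qed
  qed
qed

lemma pp_pred_ball:
  assumes "finite A" "\<And>a. a \<in> A \<Longrightarrow> pp_pred B n (Q a)"
  shows "pp_pred B n (\<lambda>v. \<forall>a\<in>A. Q a v)"
  using assms
proof (induction A rule: finite_induct)
  case empty
  then show ?case by (simp add: pp_pred_True)
next
  case (insert a A)
  then show ?case using pp_pred_conj[of B n "Q a" "\<lambda>v. \<forall>a\<in>A. Q a v"] by simp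
qed

text \<open>The quantified tuple \<open>u\<close> is stored in the variables from \<open>n\<close>
  on. By \<open>cong\<close>, overwriting these does not affect the dependence of \<open>Q\<close>
  on its first argument.\<close>

lemma pp_pred_ex_tuple:
  assumes "pp_pred B (n + m) (\<lambda>v. Q v (\<lambda>i. v (n + i)))"
    and cong: "\<And>v v' u. (\<And>i. i < n \<Longrightarrow> v i = v' i) \<Longrightarrow> Q v u \<longleftrightarrow> Q v' u"
  shows "pp_pred B n (\<lambda>v. \<exists>u. Q v u)"
proof -
  have "(\<exists>u. Q v u) \<longleftrightarrow> (\<exists>w. (\<forall>i<n. w i = v i) \<and> Q w (\<lambda>i. w (n + i)))" for v
  proof
    assume "\<exists>u. Q v u"
    then obtain u where u: "Q v u" ..
    define w where "w i = (if i < n then v i else u (i - n))" for i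
    have "(\<lambda>i. w (n + i)) = u" by (simp add: w_def)
    moreover have "Q w u" using u cong[of w v u] by (simp add: w_def)
    ultimately show "\<exists>w. (\<forall>i<n. w i = v i) \<and> Q w (\<lambda>i. w (n + i))"
      by (intro exI[of _ w]) (simp add: w_def)
  next
    assume "\<exists>w. (\<forall>i<n. w i = v i) \<and> Q w (\<lambda>i. w (n + i))"
    then obtain w where w: "\<forall>i<n. w i = v i" "Q w (\<lambda>i. w (n + i))" by (elim exE conjE)
    then have "Q v (\<lambda>i. w (n + i))" using cong[of w v "\<lambda>i. w (n + i)"] by simp
    then show "\<exists>u. Q v u" by (rule exI[of "Q v"])
  qed
  then show ?thesis using pp_pred_ex[OF assms(1)] by simp
qed

lemma pp_definable_if_pp_pred:
  assumes "pp_pred B n Q"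
  shows "pp_definable B n {xs. length xs = n \<and> Q (nth xs)}"
proof -
  obtain ps k where "\<forall>p\<in>set ps. wf_atom B p \<and> atom_vars p \<subseteq> {..<n + k}"
    "\<forall>v. Q v \<longleftrightarrow> (\<exists>w. (\<forall>i<n. w i = v i) \<and> (\<forall>p\<in>set ps. sat_atom B w p))"
    using assms unfolding pp_pred_def by (elim exE conjE)
  note wf = this(1)[rule_format] and Q = this(2)[rule_format]
  have "Q (nth xs) \<longleftrightarrow> (\<exists>ys. length ys = k \<and> (\<forall>p\<in>set ps. sat_atom B (nth (xs @ ys)) p))"
    if "length xs = n" for xs
  proof
    assume "Q (nth xs)"
    then obtain w where w: "\<forall>i<n. w i = xs ! i" "\<forall>p\<in>set ps. sat_atom B w p"
      unfolding Q by (elim exE conjE)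
    \<comment> \<open>The values of the bound variables, in the order in which they follow
      \<open>xs\<close>.\<close>
    let ?ys = "map w [n..<n + k]"
    have "sat_atom B (nth (xs @ ?ys)) p \<longleftrightarrow> sat_atom B w p" if "p \<in> set ps" for p
      using wf[OF that] w(1) \<open>length xs = n\<close> by (intro sat_atom_cong) (auto simp: nth_append)
    then show "\<exists>ys. length ys = k \<and> (\<forall>p\<in>set ps. sat_atom B (nth (xs @ ys)) p)"
      using w(2) by (intro exI[of _ ?ys]) simp
  next
    assume "\<exists>ys. length ys = k \<and> (\<forall>p\<in>set ps. sat_atom B (nth (xs @ ys)) p)"
    then obtain ys where "\<forall>p\<in>set ps. sat_atom B (nth (xs @ ys)) p" by blast
    then show "Q (nth xs)" unfolding Q using that by (intro exI[of _ "nth (xs @ ys)"]) (simp add: nth_append)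
  qed
  then show ?thesis unfolding pp_definable_def using wf by (intro exI[of _ k] exI[of _ ps]) auto
qed


section \<open>The dichotomy\<close>

text \<open>First-order definability supplies invariance under order equivalence, and preservation
  applied to a list of two tuples supplies closure under \<open>mx\<close>.\<close>

lemma mx_closed_interp:
  fixes B :: "('s, rat) relational_structure"
  assumes "strict_mono \<alpha>" "\<And>x \<epsilon>. \<epsilon> > 0 \<Longrightarrow> \<alpha> x < \<beta> x \<and> \<beta> x < \<alpha> (x + \<epsilon>)"
    and "temporal_structure B" "preserved_by B 2 (binary_op (mx \<alpha> \<beta>))" "s \<in> symbols B"
  shows "mx_closed \<alpha> \<beta> {..<arity B s} (\<lambda>v. map v [0..<arity B s] \<in> interp B s)"
proof
  show "\<alpha> x < \<beta> x" for x using assms(2)[of 1] by simp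
  show "\<beta> x < \<alpha> y" if "x < y" for x y using assms(2)[of "y - x" x] that by simp
  show "map w [0..<arity B s] \<in> interp B s"
    if "map v [0..<arity B s] \<in> interp B s" "order_equiv {..<arity B s} v w" for v w
    using fo_definable_order_equiv that assms(3,5) by (auto simp: temporal_structure_def)
  fix v w
  assume vw: "map v [0..<arity B s] \<in> interp B s" "map w [0..<arity B s] \<in> interp B s"
  let ?ts = "[map v [0..<arity B s], map w [0..<arity B s]]"
  have "map (\<lambda>i. binary_op (mx \<alpha> \<beta>) (map (\<lambda>t. t ! i) ?ts)) [0..<arity B s] \<in> interp B s"
    using assms(4,5) vw unfolding preserved_by_def by (auto dest!: bspec spec[of _ ?ts])
  also have "map (\<lambda>i. binary_op (mx \<alpha> \<beta>) (map (\<lambda>t. t ! i) ?ts)) [0..<arity B s] =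
      map (\<lambda>i. mx \<alpha> \<beta> (v i) (w i)) [0..<arity B s]"
    by (simp add: binary_op_def)
  finally show "map (\<lambda>i. mx \<alpha> \<beta> (v i) (w i)) [0..<arity B s] \<in> interp B s" .
qed (use assms(1) in auto)

lemma length_interp:
  assumes "temporal_structure B" "s \<in> symbols B" "t \<in> interp B s"
  shows "length t = arity B s"
  using assms by (auto simp: temporal_structure_def fo_definable_def)

theorem theorem5p2:
  fixes B :: "('s, rat) relational_structure"
    and \<alpha> \<beta> :: "rat \<Rightarrow> rat"
  assumes "strict_mono \<alpha>" and "strict_mono \<beta>"
    and "\<And>x \<epsilon>. \<epsilon> > 0 \<Longrightarrow> \<alpha> x < \<beta> x \<and> \<beta> x < \<alpha> (x + \<epsilon>)"
    and "temporal_structure B"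
    and "preserved_by B 2 (binary_op (mx \<alpha> \<beta>))"
  shows "pp_definable B 3 X_rel
       \<or> (\<exists>n f. constant_operation n f \<and> preserved_by B n f)
       \<or> preserved_by B 2 (binary_op min)"
proof -
  define P where "P s v \<longleftrightarrow> map v [0..<arity B s] \<in> interp B s" for s and v :: "nat \<Rightarrow> rat"
  have closed: "mx_closed \<alpha> \<beta> {..<arity B s} (P s)" if "s \<in> symbols B" for s
    using mx_closed_interp[OF assms(1,3-5) that] by (simp add: P_def [abs_def])
  have P_nth: "P s (nth t)" if "s \<in> symbols B" "t \<in> interp B s" for s t
    unfolding P_def using that length_interp[OF assms(4) that] by (metis map_nth)
  have pp_P: "pp_pred B (n + arity B s) (\<lambda>v. P s (\<lambda>i. v (n + i)))" if "s \<in> symbols B" for n s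
    unfolding P_def using that by (intro pp_pred_rel) auto
  have "pp_definable B 3 X_rel"
    if no_const: "\<And>n f. constant_operation n f \<Longrightarrow> \<not> preserved_by B n f"
      and no_min: "\<not> preserved_by B 2 (binary_op min)"
  proof -
    have "constant_operation 1 (\<lambda>_. 0::rat)" by (simp add: constant_operation_def)
    then have "\<not> preserved_by B 1 (\<lambda>_. 0::rat)" using no_const by blast
    then obtain s ts where s: "s \<in> symbols B" "length ts = 1" "set ts \<subseteq> interp B s" and "\<not> P s (\<lambda>_. 0)"
      unfolding preserved_by_def P_def by blast
    have "hd ts \<in> interp B s" using s by (cases ts) auto
    then have "\<exists>v. P s v" using P_nth s(1) by blast
    obtain S C where SC: "S \<subseteq> {..<arity B s}" "C \<subseteq> S"
      and less: "\<forall>x y. (\<exists>u. P s u \<and> (\<forall>i\<in>C. u i = x) \<and> (\<forall>i\<in>S - C. u i = y)) \<longleftrightarrow> x < y"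
      by (rule mx_closed.defines_less[OF closed[OF s(1)] \<open>\<exists>v. P s v\<close> \<open>\<not> P s (\<lambda>_. 0)\<close>])
    have "finite S" using SC(1) finite_lessThan by (rule finite_subset)
    with SC(2) have "finite C" by (rule finite_subset)
    have "pp_pred B 2 (\<lambda>v. \<exists>u. P s u \<and> (\<forall>i\<in>C. u i = v 0) \<and> (\<forall>i\<in>S - C. u i = v 1))"
      using SC \<open>finite S\<close> \<open>finite C\<close>
      by (intro pp_pred_ex_tuple[where m = "arity B s"] pp_pred_conj pp_pred_ball pp_pred_eq pp_P s(1))
        auto
    then have pp_less: "pp_pred B 2 (\<lambda>v. v 0 < v 1)" by (simp only: less[rule_format])
    have pp_less': "pp_pred B n (\<lambda>v. v i < v j)" if "i < n" "j < n" for i j n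
    proof -
      \<comment> \<open>The trivial conditionals display the substitution of \<open>i\<close> for
        variable 0 and \<open>j\<close> for variable 1.\<close>
      have "pp_pred B n (\<lambda>v. v (if (0::nat) = 0 then i else j) < v (if (1::nat) = 0 then i else j))"
        by (rule pp_pred_subst[OF pp_less]) (use that in auto)
      then show ?thesis by simp
    qed
    obtain s' ts' where s': "s' \<in> symbols B" and ts': "length ts' = 2" "set ts' \<subseteq> interp B s'"
      and not_min: "map (\<lambda>i. binary_op min (map (\<lambda>t. t ! i) ts')) [0..<arity B s'] \<notin> interp B s'"
      using no_min unfolding preserved_by_def by blast
    obtain r t where ts'_eq: "ts' = [r, t]" using ts'(1) by (auto simp: numeral_2_eq_2 length_Suc_conv)
    have r: "P s' (nth r)" and t: "P s' (nth t)" using P_nth s' ts'(2) ts'_eq by auto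
    have min: "\<not> P s' (\<lambda>i. min (r ! i) (t ! i))"
      using not_min by (simp add: ts'_eq binary_op_def P_def)
    obtain A A' A'' D where A: "A \<subseteq> {..<arity B s'}" "A' \<subseteq> {..<arity B s'}"
        "A'' \<subseteq> {..<arity B s'}" "D \<subseteq> {..<arity B s'}"
      and X: "\<forall>x y z. (\<exists>u. P s' u \<and> (\<forall>i\<in>A. u i = x) \<and> (\<forall>i\<in>A'. u i = y) \<and> (\<forall>i\<in>A''. u i = z)
            \<and> (\<forall>i\<in>D. x < u i))
        \<longleftrightarrow> (x = y \<and> y < z) \<or> (y = z \<and> z < x) \<or> (z = x \<and> x < y)"
      by (rule mx_closed.defines_X[OF closed[OF s'] r t min])
    note fin = A[THEN finite_subset, OF finite_lessThan]
    \<comment> \<open>The constraint on \<open>D\<close> is where the definition of the order,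
      obtained from the possibly different relation \<open>s\<close>, enters.\<close>
    have "pp_pred B 3 (\<lambda>v. \<exists>u. P s' u \<and> (\<forall>i\<in>A. u i = v 0) \<and> (\<forall>i\<in>A'. u i = v 1)
        \<and> (\<forall>i\<in>A''. u i = v 2) \<and> (\<forall>i\<in>D. v 0 < u i))"
      using A fin
      by (intro pp_pred_ex_tuple[where m = "arity B s'"] pp_pred_conj pp_pred_ball pp_pred_eq
          pp_less' pp_P s') auto
    then have "pp_definable B 3 {xs. length xs = 3 \<and> ((xs ! 0 = xs ! 1 \<and> xs ! 1 < xs ! 2)
        \<or> (xs ! 1 = xs ! 2 \<and> xs ! 2 < xs ! 0) \<or> (xs ! 2 = xs ! 0 \<and> xs ! 0 < xs ! 1))}"
      unfolding X[rule_format] by (rule pp_definable_if_pp_pred)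
    also have "{xs. length xs = 3 \<and> ((xs ! 0 = xs ! 1 \<and> xs ! 1 < xs ! 2)
        \<or> (xs ! 1 = xs ! 2 \<and> xs ! 2 < xs ! 0) \<or> (xs ! 2 = xs ! 0 \<and> xs ! 0 < xs ! 1))} = X_rel"
      unfolding X_rel_def by (auto simp: numeral_3_eq_3 numeral_2_eq_2 length_Suc_conv)
    finally show ?thesis .
  qed
  then show ?thesis by blast
qed

end
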